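(* For any $T_0$ space $X$, the following conditions are equivalent: (1) $X$ is well-filtered. (2) For each $A\in \mathsf{WD}(X)$ and each $K\in\mathbf{up}(X)$, $\max(A)\neq\emptyset$ and $\mathord{\downarrow}(A\cap K)$ is closed in $X$. (3) For each $A\in \mathsf{RD}(X)$ and each $K\in\mathbf{up}(X)$, $\max(A)\neq\emptyset$ and $\mathord{\downarrow}(A\cap K)$ is closed in $X$. (4) For each $A\in \mathsf{WD}(X)$ and each $K\in\mathsf{K}(X)$, $\max(A)\neq\emptyset$ and $\mathord{\downarrow}(A\cap K)$ is closed in $X$. (5) For each $A\in \mathsf{RD}(X)$ and each $K\in\mathsf{K}(X)$, $\max(A)\neq\emptyset$ and $\mathord{\downarrow}(A\cap K)$ is closed in $X$.
   Context: A $T_0$ space $X$ is regarded as a poset under its specialization order: $x\leq y$ iff $x\in\overline{\{y\}}$. $\mathord{\uparrow}$ and $\mathord{\downarrow}$ denote upper and lower closures in this order, and $\max(A)$ is the set of maximal elements of $A$. $\mathbf{up}(X)$ is the set of all nonempty upper subsets of $X$. A set is saturated if it is an intersection of open sets (equivalently, an upper set); $\mathsf{K}(X)$ is the set of all nonempty compact saturated subsets of $X$. A family $\mathcal K\subseteq\mathsf{K}(X)$ is filtered if it is nonempty and any two members contain a common third member. $X$ is well-filtered if it is $T_0$ and for every open $U$ and every filtered $\mathcal K\subseteq\mathsf{K}(X)$, $\bigcap\mathcal K\subseteq U$ implies $K\subseteq U$ for some $K\in\mathcal K$. $\mathsf{RD}(X)$ is the set of nonempty closed subsets $A$ of $X$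 for which there is a filtered family $\mathcal K\subseteq\mathsf{K}(X)$ such that $A$ is minimal (under inclusion) among the closed sets meeting every member of $\mathcal K$. $\mathsf{WD}(X)$ is the set of closed subsets $A$ of $X$ such that for every continuous map $f:X\to Y$ into a well-filtered space $Y$ there is a unique $y\in Y$ with $\overline{f(A)}=\overline{\{y\}}$. *)

theory Defs
  imports "HOL-Analysis.Abstract_Topological_Spaces"
begin

definition spec_le :: "'a topology \<Rightarrow> 'a \<Rightarrow> 'a \<Rightarrow> bool" where
  "spec_le X x y \<longleftrightarrow> x \<in> topspace X \<and> y \<in> topspace X \<and> x \<in> X closure_of {y}"

definition down_closure :: "'a topology \<Rightarrow> 'a set \<Rightarrow> 'a set" where
  "down_closure X A = {x. \<exists>a\<in>A. spec_le X x a}"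

definition maximal_points :: "'a topology \<Rightarrow> 'a set \<Rightarrow> 'a set" where
  "maximal_points X A = {a\<in>A. \<forall>b\<in>A. spec_le X a b \<longrightarrow> b = a}"

definition up_sets :: "'a topology \<Rightarrow> 'a set set" where
  "up_sets X =
     {A. A \<noteq> {} \<and> A \<subseteq> topspace X \<and> (\<forall>x\<in>A. \<forall>y. spec_le X x y \<longrightarrow> y \<in> A)}"

text \<open>The intersection with \<open>topspace X\<close> only matters for the empty family, whose
  intersection is the whole space.\<close>

definition saturatedin :: "'a topology \<Rightarrow> 'a set \<Rightarrow> bool" where
  "saturatedin X A \<longleftrightarrow>
     (\<exists>\<U>. (\<forall>U\<in>\<U>. openin X U) \<and> A = topspace X \<inter> \<Inter>\<U>)"

definition compact_saturated_sets :: "'a topology \<Rightarrow> 'a set set" where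
  "compact_saturated_sets X = {K. K \<noteq> {} \<and> compactin X K \<and> saturatedin X K}"

definition filtered_family :: "'a set set \<Rightarrow> bool" where
  "filtered_family \<K> \<longleftrightarrow>
     \<K> \<noteq> {} \<and> (\<forall>K1\<in>\<K>. \<forall>K2\<in>\<K>. \<exists>K3\<in>\<K>. K3 \<subseteq> K1 \<inter> K2)"

definition well_filtered_space :: "'a topology \<Rightarrow> bool" where
  "well_filtered_space X \<longleftrightarrow>
     t0_space X \<and>
     (\<forall>U \<K>. openin X U \<and> \<K> \<subseteq> compact_saturated_sets X \<and> filtered_family \<K> \<and> \<Inter>\<K> \<subseteq> U
        \<longrightarrow> (\<exists>K\<in>\<K>. K \<subseteq> U))"

definition RD_sets :: "'a topology \<Rightarrow> 'a set set" where
  "RD_sets X =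
     {A. closedin X A \<and> A \<noteq> {} \<and>
         (\<exists>\<K>. \<K> \<subseteq> compact_saturated_sets X \<and> filtered_family \<K> \<and>
               (\<forall>K\<in>\<K>. A \<inter> K \<noteq> {}) \<and>
               (\<forall>B. closedin X B \<and> (\<forall>K\<in>\<K>. B \<inter> K \<noteq> {}) \<and> B \<subseteq> A \<longrightarrow> B = A))}"

text \<open>A definition cannot quantify over types, so the test spaces \<open>Y\<close> are taken on the type
  \<open>'a set\<close>.  This is no restriction: by \<open>WD_sets_dest\<close> below, every member of \<open>WD_sets X\<close>
  satisfies the defining condition for well-filtered spaces over an arbitrary type.\<close>

definition WD_sets :: "'a topology \<Rightarrow> 'a set set" where
  "WD_sets X =
     {A. closedin X A \<and>
         (\<forall>(Y :: 'a set topology) f. well_filtered_space Y \<and> continuous_map X Y f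
            \<longrightarrow> (\<exists>!y. y \<in> topspace Y \<and> Y closure_of (f ` A) = Y closure_of {y}))}"


subsection \<open>Independence of the type of the test spaces\<close>

lemma minimal_closed_meeting:
  assumes comp: "\<And>K. K \<in> \<K> \<Longrightarrow> compactin X K"
    and F: "closedin X F" "\<And>K. K \<in> \<K> \<Longrightarrow> F \<inter> K \<noteq> {}"
  obtains D where "closedin X D" "D \<subseteq> F" "\<And>K. K \<in> \<K> \<Longrightarrow> D \<inter> K \<noteq> {}"
    "\<And>B. \<lbrakk>closedin X B; B \<subseteq> D; \<And>K. K \<in> \<K> \<Longrightarrow> B \<inter> K \<noteq> {}\<rbrakk> \<Longrightarrow> B = D"
proof -
  define \<A> where "\<A> = {U. openin X U \<and> topspace X - F \<subseteq> U \<and> (\<forall>K\<in>\<K>. \<not> K \<subseteq> U)}"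
  have K_sub: "K \<subseteq> topspace X" if "K \<in> \<K>" for K
    using comp[OF that] compactin_subset_topspace by blast
  have "topspace X - F \<in> \<A>"
    using F by (auto simp: \<A>_def)
  moreover have "\<Union>\<C> \<in> \<A>" if "\<C> \<noteq> {}" and ch: "subset.chain \<A> \<C>" for \<C>
  proof -
    have sub: "\<C> \<subseteq> \<A>"
      using ch by (simp add: subset.chain_def)
    have op: "\<And>U. U \<in> \<C> \<Longrightarrow> openin X U"
      using sub by (auto simp: \<A>_def)
    have "\<not> K \<subseteq> \<Union>\<C>" if K: "K \<in> \<K>" for K
    proof
      assume "K \<subseteq> \<Union>\<C>"
      then obtain \<F> where \<F>: "finite \<F>" "\<F> \<subseteq> \<C>" "K \<subseteq> \<Union>\<F>"
        using comp[OF K] op unfolding compactin_def by meson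
      have "\<exists>U\<in>\<C>. \<Union>\<F> \<subseteq> U"
      proof (cases "\<F> = {}")
        case True
        then show ?thesis using \<open>\<C> \<noteq> {}\<close> by auto
      next
        case False
        then have "\<Union>\<F> \<in> \<F>"
          using \<F> ch by (intro Union_in_chain[where \<A>=\<A>]) (simp_all, meson subset.chain_def subset_trans subsetD)
        then show ?thesis using \<F> by blast
      qed
      then obtain U where U: "U \<in> \<C>" "\<Union>\<F> \<subseteq> U"
        by (elim bexE)
      have "U \<in> \<A>"
        using sub U(1) by (rule subsetD)
      then have "\<not> K \<subseteq> U"
        using K by (simp add: \<A>_def)
      then show False
        using subset_trans[OF \<F>(3) U(2)] by (rule notE)
    qed
    moreover have "openin X (\<Union>\<C>)"
      using op by blast
    moreover have "topspace X - F \<subseteq> \<Union>\<C>"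
    proof -
      obtain U where "U \<in> \<C>"
        using \<open>\<C> \<noteq> {}\<close> by blast
      moreover have "topspace X - F \<subseteq> U"
        using \<open>U \<in> \<C>\<close> sub by (auto simp: \<A>_def)
      ultimately show ?thesis
        by blast
    qed
    ultimately show ?thesis
      by (auto simp: \<A>_def)
  qed
  ultimately obtain M where M: "M \<in> \<A>" "\<And>U. \<lbrakk>U \<in> \<A>; M \<subseteq> U\<rbrakk> \<Longrightarrow> U = M"
    using subset_Zorn_nonempty[of \<A>] by blast
  show thesis
  proof
    show "closedin X (topspace X - M)"
      using M by (auto simp: \<A>_def)
    show "topspace X - M \<subseteq> F"
      using M by (auto simp: \<A>_def)
    show "(topspace X - M) \<inter> K \<noteq> {}" if "K \<in> \<K>" for K
    proof -
      have "\<not> K \<subseteq> M"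
        using M(1) that by (simp add: \<A>_def)
      then show ?thesis
        using K_sub[OF that] by blast
    qed
    fix B assume B: "closedin X B" "B \<subseteq> topspace X - M" "\<And>K. K \<in> \<K> \<Longrightarrow> B \<inter> K \<noteq> {}"
    have Mop: "openin X M" "topspace X - F \<subseteq> M"
      using M by (auto simp: \<A>_def)
    have "M \<subseteq> topspace X - B"
      using B(2) openin_subset[OF Mop(1)] by blast
    moreover have "topspace X - B \<in> \<A>"
    proof -
      have "\<not> K \<subseteq> topspace X - B" if "K \<in> \<K>" for K
        using B(3)[OF that] by blast
      then show ?thesis
        using B(1) Mop(2) calculation by (auto simp: \<A>_def)
    qed
    ultimately have "topspace X - B = M"
      using M(2) by blast
    then show "B = topspace X - M"
      using closedin_subset[OF B(1)] by blast
  qed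
qed

lemma closure_of_continuous_image:
  assumes "continuous_map W Y h" "S \<subseteq> topspace W"
  shows "Y closure_of (h ` (W closure_of S)) = Y closure_of (h ` S)"
proof
  show "Y closure_of (h ` (W closure_of S)) \<subseteq> Y closure_of (h ` S)"
    using continuous_map_image_closure_subset[OF assms(1)]
    by (simp add: closure_of_minimal)
  show "Y closure_of (h ` S) \<subseteq> Y closure_of (h ` (W closure_of S))"
    using closure_of_subset[OF assms(2)] by (simp add: closure_of_mono image_mono)
qed

lemma well_filtered_space_initial:
  fixes W :: "'b topology" and Y :: "'c topology"
  assumes Y: "well_filtered_space Y"
    and W: "\<And>U. openin W U \<longleftrightarrow> (\<exists>V. openin Y V \<and> U = h -` V \<inter> topspace W)"
    and h: "h ` topspace W \<subseteq> topspace Y" "inj_on h (topspace W)"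
    and cl: "\<And>C y. \<lbrakk>C \<subseteq> topspace W; y \<in> topspace Y; Y closure_of (h ` C) = Y closure_of {y}\<rbrakk>
               \<Longrightarrow> y \<in> h ` topspace W"
  shows "well_filtered_space W"
  unfolding well_filtered_space_def
proof (intro conjI allI impI)
  have Y0: "t0_space Y"
    using Y by (simp add: well_filtered_space_def)
  show "t0_space W"
    unfolding t0_space_def
  proof (intro ballI impI)
    fix x y assume xy: "x \<in> topspace W" "y \<in> topspace W" "x \<noteq> y"
    then have "h x \<noteq> h y" "h x \<in> topspace Y" "h y \<in> topspace Y"
      using h by (auto dest: inj_onD)
    then obtain V where "openin Y V" "h x \<notin> V \<longleftrightarrow> h y \<in> V"
      using Y0 unfolding t0_space_def by blast
    then show "\<exists>U. openin W U \<and> (x \<notin> U \<longleftrightarrow> y \<in> U)"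
      using xy by (intro exI[of _ "h -` V \<inter> topspace W"]) (auto simp: W)
  qed
  have cont: "continuous_map W Y h"
    unfolding continuous_map_alt using h by (auto simp: W)
  fix U \<K>
  assume *: "openin W U \<and> \<K> \<subseteq> compact_saturated_sets W \<and> filtered_family \<K> \<and> \<Inter>\<K> \<subseteq> U"
  then have UW: "openin W U" and \<K>_sat: "\<And>K. K \<in> \<K> \<Longrightarrow> K \<in> compact_saturated_sets W"
    and \<K>_filt: "filtered_family \<K>" and \<K>_U: "\<Inter>\<K> \<subseteq> U"
    by auto
  obtain V where V: "openin Y V" "U = h -` V \<inter> topspace W"
    using UW unfolding W[of U] by (elim exE conjE)
  have K: "K \<noteq> {}" "compactin W K" "saturatedin W K" "K \<subseteq> topspace W" if "K \<in> \<K>" for K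
    using \<K>_sat[OF that] by (simp_all add: compact_saturated_sets_def compactin_subset_topspace)
  define L where "L K = topspace Y \<inter> \<Inter>{V. openin Y V \<and> h ` K \<subseteq> V}" for K
  have L_up: "h ` K \<subseteq> L K" if "K \<in> \<K>" for K
    using K(4)[OF that] h by (auto simp: L_def)
  have L_open: "L K \<subseteq> V'" if "openin Y V'" "h ` K \<subseteq> V'" for K V'
    using that by (auto simp: L_def)
  have L_comp: "compactin Y (L K)" if "K \<in> \<K>" for K
    unfolding compactin_def
  proof (intro conjI allI impI)
    show "L K \<subseteq> topspace Y" by (auto simp: L_def)
    fix \<U> assume \<U>: "(\<forall>U\<in>\<U>. openin Y U) \<and> L K \<subseteq> \<Union>\<U>"
    have cover: "h ` K \<subseteq> \<Union>\<U>"
      using L_up[OF that] conjunct2[OF \<U>] by (rule subset_trans)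
    have "compactin Y (h ` K)"
      using K(2)[OF that] cont image_compactin by blast
    then obtain \<F> where \<F>: "finite \<F>" "\<F> \<subseteq> \<U>" "h ` K \<subseteq> \<Union>\<F>"
      using \<U> cover unfolding compactin_def by meson
    have "openin Y (\<Union>\<F>)"
      using \<U> \<F>(2) by (intro openin_Union) auto
    then have "L K \<subseteq> \<Union>\<F>"
      using \<F>(3) by (rule L_open)
    then show "\<exists>\<F>. finite \<F> \<and> \<F> \<subseteq> \<U> \<and> L K \<subseteq> \<Union>\<F>"
      using \<F> by (intro exI[of _ \<F>] conjI)
  qed
  have L_sat: "L ` \<K> \<subseteq> compact_saturated_sets Y"
  proof
    fix Q assume "Q \<in> L ` \<K>"
    then obtain K' where K': "K' \<in> \<K>" "Q = L K'" by blast
    have "saturatedin Y Q"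
      unfolding saturatedin_def K'(2) L_def
      by (intro exI[of _ "{V. openin Y V \<and> h ` K' \<subseteq> V}"]) simp
    then show "Q \<in> compact_saturated_sets Y"
      using L_comp[OF K'(1)] L_up[OF K'(1)] K(1)[OF K'(1)] K'(2)
      by (auto simp: compact_saturated_sets_def)
  qed
  have L_mono: "L K1 \<subseteq> L K2" if "K1 \<subseteq> K2" for K1 K2
    using that by (force simp: L_def)
  have L_filt: "filtered_family (L ` \<K>)"
    unfolding filtered_family_def
  proof (intro conjI ballI)
    show "L ` \<K> \<noteq> {}"
      using \<K>_filt by (auto simp: filtered_family_def)
    fix Q1 Q2 assume "Q1 \<in> L ` \<K>" "Q2 \<in> L ` \<K>"
    then obtain K1 K2 where K12: "K1 \<in> \<K>" "K2 \<in> \<K>" "Q1 = L K1" "Q2 = L K2" by blast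
    then obtain K3 where "K3 \<in> \<K>" "K3 \<subseteq> K1 \<inter> K2"
      using \<K>_filt unfolding filtered_family_def by meson
    then show "\<exists>Q3\<in>L ` \<K>. Q3 \<subseteq> Q1 \<inter> Q2"
      using L_mono K12 by (intro bexI[of _ "L K3"]) auto
  qed
  show "\<exists>K\<in>\<K>. K \<subseteq> U"
  proof (rule ccontr)
    assume neg: "\<not> (\<exists>K\<in>\<K>. K \<subseteq> U)"
    have "(topspace Y - V) \<inter> Q \<noteq> {}" if Q: "Q \<in> L ` \<K>" for Q
    proof -
      obtain K' where K': "K' \<in> \<K>" "Q = L K'" using Q by blast
      obtain x where x: "x \<in> K'" "x \<notin> U" using neg K' by blast
      then have "x \<in> topspace W" using K(4)[OF K'(1)] by blast
      then have "h x \<in> topspace Y - V" using x V h by blast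
      moreover have "h x \<in> Q" using L_up[OF K'(1)] x K' by blast
      ultimately show ?thesis by blast
    qed
    moreover have "closedin Y (topspace Y - V)"
      using V by blast
    ultimately obtain D where D: "closedin Y D" "D \<subseteq> topspace Y - V"
        "\<And>Q. Q \<in> L ` \<K> \<Longrightarrow> D \<inter> Q \<noteq> {}"
        "\<And>B. \<lbrakk>closedin Y B; B \<subseteq> D; \<And>Q. Q \<in> L ` \<K> \<Longrightarrow> B \<inter> Q \<noteq> {}\<rbrakk> \<Longrightarrow> B = D"
      using minimal_closed_meeting[of "L ` \<K>" Y "topspace Y - V"] L_comp by blast
    have "\<not> \<Inter>(L ` \<K>) \<subseteq> topspace Y - D"
    proof
      assume "\<Inter>(L ` \<K>) \<subseteq> topspace Y - D"
      moreover have "openin Y (topspace Y - D)" using D(1) by blast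
      ultimately obtain Q where "Q \<in> L ` \<K>" "Q \<subseteq> topspace Y - D"
        using Y L_sat L_filt unfolding well_filtered_space_def by meson
      then show False using D(3) by blast
    qed
    moreover have "\<Inter>(L ` \<K>) \<subseteq> topspace Y"
      using \<K>_filt by (auto simp: L_def filtered_family_def)
    ultimately obtain y where y: "y \<in> D" "\<And>K. K \<in> \<K> \<Longrightarrow> y \<in> L K" by blast
    have yY: "y \<in> topspace Y" using y D(2) by blast
    have Dy: "Y closure_of {y} = D"
    proof (rule D(4))
      show "Y closure_of {y} \<subseteq> D" using y D(1) by (simp add: closure_of_minimal)
      have "y \<in> Y closure_of {y}" using yY by (simp add: in_closure_of)
      then show "Y closure_of {y} \<inter> Q \<noteq> {}" if "Q \<in> L ` \<K>" for Q using that y by blast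
    qed simp
    define C where "C = h -` D \<inter> topspace W"
    have hC: "h ` C \<subseteq> D" "h ` C \<subseteq> topspace Y" using D(2) by (auto simp: C_def)
    have "Y closure_of (h ` C) = D"
    proof (rule D(4))
      show "Y closure_of (h ` C) \<subseteq> D" using hC D(1) by (simp add: closure_of_minimal)
      fix Q assume "Q \<in> L ` \<K>"
      then obtain K' where K': "K' \<in> \<K>" "Q = L K'" by blast
      have "\<not> h ` K' \<subseteq> topspace Y - D"
        using L_open[of "topspace Y - D" K'] D(3)[of Q] D(1) K' by blast
      then obtain x where "x \<in> K'" "h x \<in> D"
        using K(4)[OF K'(1)] h by blast
      then have "h x \<in> h ` C" "h x \<in> Q"
        using K(4)[OF K'(1)] L_up[OF K'(1)] K' by (auto simp: C_def)
      then show "Y closure_of (h ` C) \<inter> Q \<noteq> {}"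
        using closure_of_subset[OF hC(2)] by blast
    qed simp
    then obtain w where w: "w \<in> topspace W" "y = h w"
      using cl[of C y] Dy yY by (auto simp: C_def)
    have "w \<in> K'" if K': "K' \<in> \<K>" for K'
    proof -
      obtain \<U> where \<U>: "\<forall>U\<in>\<U>. openin W U" "K' = topspace W \<inter> \<Inter>\<U>"
        using K(3)[OF K'] unfolding saturatedin_def by blast
      have "w \<in> U'" if "U' \<in> \<U>" for U'
      proof -
        have "openin W U'" using \<U>(1) that by (rule bspec)
        then obtain V' where V': "openin Y V'" "U' = h -` V' \<inter> topspace W"
          unfolding W[of U'] by (elim exE conjE)
        have "K' \<subseteq> U'" using \<U>(2) that by auto
        then have "h ` K' \<subseteq> V'" using V'(2) by auto
        then have "y \<in> V'" using L_open[OF V'(1)] y(2)[OF K'] by (simp add: subset_iff)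
        then show ?thesis using V'(2) w by simp
      qed
      then show ?thesis using \<U>(2) w(1) by simp
    qed
    then have "w \<in> U" using \<K>_U by (simp add: subset_iff)
    then show False using V(2) w(2) y(1) D(2) by auto
  qed
qed

lemma WD_sets_dest:
  fixes X :: "'a topology" and Y :: "'b topology"
  assumes A: "A \<in> WD_sets X" and Y: "well_filtered_space Y" and f: "continuous_map X Y f"
  shows "\<exists>!y. y \<in> topspace Y \<and> Y closure_of (f ` A) = Y closure_of {y}"
proof -
  have Y0: "t0_space Y" using Y by (simp add: well_filtered_space_def)
  have fX: "f ` topspace X \<subseteq> topspace Y" using f by (rule continuous_map_image_subset_topspace)
  have AX: "A \<subseteq> topspace X" using A by (auto simp: WD_sets_def dest: closedin_subset)
  define P where "P y B \<longleftrightarrow> B \<subseteq> topspace X \<and> Y closure_of (f ` B) = Y closure_of {y}" for y B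
  define Z where "Z = {y \<in> topspace Y. \<exists>B. P y B}"
  define g where "g y = (SOME B. P y B)" for y
  have g: "P y (g y)" if "y \<in> Z" for y
    using that unfolding Z_def g_def by (auto intro: someI_ex)
  have inj: "inj_on g Z"
  proof (rule inj_onI)
    fix y z assume "y \<in> Z" "z \<in> Z" "g y = g z"
    then show "y = z"
      using g[of y] g[of z] Y0 unfolding t0_space_closure_of_sing P_def Z_def by auto
  qed
  define h where "h = inv_into Z g"
  have hg: "h (g y) = y" if "y \<in> Z" for y
    using that inj by (simp add: h_def)
  define W where "W = pullback_topology (g ` Z) h Y"
  have topW: "topspace W = g ` Z"
    using hg by (auto simp: W_def topspace_pullback_topology Z_def)
  have W: "openin W U \<longleftrightarrow> (\<exists>V. openin Y V \<and> U = h -` V \<inter> topspace W)" for U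
    by (simp add: topW) (simp add: W_def openin_pullback_topology)
  have hW: "h ` topspace W = Z" using hg by (force simp: topW)
  have fZ: "f x \<in> Z" if "x \<in> topspace X" for x
    using that fX unfolding Z_def P_def by (auto intro!: exI[of _ "{x}"])
  have wfW: "well_filtered_space W"
  proof (rule well_filtered_space_initial[OF Y W])
    show "h ` topspace W \<subseteq> topspace Y" by (auto simp: hW Z_def)
    show "inj_on h (topspace W)" using hg by (auto simp: topW inj_on_def)
    fix C y assume C: "C \<subseteq> topspace W" "y \<in> topspace Y" "Y closure_of (h ` C) = Y closure_of {y}"
    define B where "B = \<Union>C"
    have CP: "P (h c) c" if "c \<in> C" for c
      using that C(1) g hg by (auto simp: topW)
    have hCY: "h ` C \<subseteq> topspace Y" using C(1) hW by (auto simp: Z_def)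
    have BX: "B \<subseteq> topspace X" using CP by (auto simp: B_def P_def)
    have "Y closure_of (f ` B) = Y closure_of (h ` C)"
    proof
      show "Y closure_of (f ` B) \<subseteq> Y closure_of (h ` C)"
      proof (rule closure_of_minimal)
        show "f ` B \<subseteq> Y closure_of (h ` C)"
        proof
          fix z assume "z \<in> f ` B"
          then obtain c where c: "c \<in> C" "z \<in> f ` c" by (auto simp: B_def)
          have "f ` c \<subseteq> Y closure_of (f ` c)"
            using CP[OF c(1)] fX by (intro closure_of_subset) (auto simp: P_def)
          then have "z \<in> Y closure_of {h c}" using c CP[OF c(1)] by (auto simp: P_def)
          then show "z \<in> Y closure_of (h ` C)"
            using closure_of_mono[of "{h c}" "h ` C" Y] c by auto
        qed
      qed simp
      show "Y closure_of (h ` C) \<subseteq> Y closure_of (f ` B)"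
      proof (rule closure_of_minimal)
        show "h ` C \<subseteq> Y closure_of (f ` B)"
        proof
          fix z assume "z \<in> h ` C"
          then obtain c where c: "c \<in> C" "z = h c" by blast
          have "z \<in> Y closure_of {h c}" using c hCY by (auto simp: in_closure_of)
          then have "z \<in> Y closure_of (f ` c)" using CP[OF c(1)] by (simp add: P_def)
          then show "z \<in> Y closure_of (f ` B)"
            using closure_of_mono[of "f ` c" "f ` B" Y] c by (auto simp: B_def)
        qed
      qed simp
    qed
    then have "P y B" using BX C by (simp add: P_def)
    then show "y \<in> h ` topspace W" using C(2) by (auto simp: hW Z_def)
  qed
  have hcont: "continuous_map W Y h"
    unfolding continuous_map_alt using hW by (auto simp: W Z_def)
  have "continuous_map X W (g \<circ> f)"
    unfolding continuous_map_alt
  proof (intro conjI allI impI)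
    show "g \<circ> f \<in> topspace X \<rightarrow> topspace W" using fZ by (auto simp: topW)
    fix U assume "openin W U"
    then obtain V where V: "openin Y V" "U = h -` V \<inter> topspace W" unfolding W by blast
    have "(g \<circ> f) -` U \<inter> topspace X = f -` V \<inter> topspace X"
      using V fZ hg by (auto simp: topW)
    then show "openin X ((g \<circ> f) -` U \<inter> topspace X)"
      using f V(1) by (simp add: continuous_map_alt)
  qed
  then obtain w where w: "w \<in> topspace W" "W closure_of ((g \<circ> f) ` A) = W closure_of {w}"
    using A wfW unfolding WD_sets_def by blast
  have gfA: "(g \<circ> f) ` A \<subseteq> topspace W" using AX fZ by (auto simp: topW)
  have "h ` (g \<circ> f) ` A = f ` A" using AX fZ hg by (force simp: image_image)
  then have "Y closure_of (f ` A) = Y closure_of {h w}"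
    using closure_of_continuous_image[OF hcont gfA] closure_of_continuous_image[OF hcont, of "{w}"] w
    by simp
  moreover have "h w \<in> topspace Y" using w hW by (auto simp: Z_def)
  ultimately show ?thesis
    using Y0 unfolding t0_space_closure_of_sing by metis
qed

end

theory Submission
  imports Defs
begin

text \<open>
  Everything rests on two facts about a \<open>T\<^sub>0\<close> space \<open>X\<close>.

  In a well-filtered space a member \<open>A\<close> of \<open>WD_sets X\<close> is the closure of a point \<open>y\<close>: test
  \<open>A\<close> against the identity map. Such a set has the largest element \<open>y\<close>, and an upper set \<open>K\<close> that
  meets it contains \<open>y\<close>, so the down-closure of \<open>A \<inter> K\<close> is either empty or all of \<open>A\<close>. This
  gives the strongest of the four conditions.

  Conversely, if \<open>X\<close> is not well-filtered, there are an open \<open>U\<close> and a filtered family \<open>\<K>\<close> of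
  compact saturated sets with \<open>\<Inter>\<K> \<subseteq> U\<close> such that the complement of \<open>U\<close> meets every member of
  \<open>\<K>\<close>. By compactness and Zorn's lemma the complement contains a minimal closed set \<open>D\<close> that meets
  every member, and \<open>D\<close> lies in \<open>RD_sets X\<close>. If each down-closure of \<open>D \<inter> K\<close> is closed, minimality
  forces it to be \<open>D\<close>, so a maximal point of \<open>D\<close> lies in every \<open>K\<close>, hence in \<open>U\<close>: a
  contradiction. So the weakest condition, about \<open>RD_sets X\<close> and compact saturated sets, already
  implies well-filteredness.

  The conditions in between are linked by the inclusions of the compact saturated sets in the upper
  sets and of \<open>RD_sets X\<close> in \<open>WD_sets X\<close> (lemma \<open>RD_sets_subset_WD_sets\<close>).
\<close>

section \<open>The specialization order\<close>

lemma spec_le_refl: "x \<in> topspace X \<Longrightarrow> spec_le X x x"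
  by (simp add: spec_le_def in_closure_of)

lemma spec_le_openD:
  assumes "spec_le X x y" "openin X U" "x \<in> U"
  shows "y \<in> U"
  using assms by (auto simp: spec_le_def in_closure_of)

lemma spec_le_closedD:
  assumes "spec_le X x y" "closedin X C" "y \<in> C"
  shows "x \<in> C"
  using assms closure_of_minimal[of "{y}" C X] by (auto simp: spec_le_def)

lemma compact_saturated_sets_subset_up_sets: "compact_saturated_sets X \<subseteq> up_sets X"
proof
  fix K assume K: "K \<in> compact_saturated_sets X"
  then obtain \<U> where \<U>: "\<forall>U\<in>\<U>. openin X U" "K = topspace X \<inter> \<Inter>\<U>"
    by (auto simp: compact_saturated_sets_def saturatedin_def)
  have upper: "y \<in> K" if "x \<in> K" "spec_le X x y" for x y
  proof -
    have "y \<in> U" if "U \<in> \<U>" for U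
      using \<U> \<open>x \<in> K\<close> \<open>spec_le X x y\<close> that spec_le_openD[of X x y U] by simp
    then show ?thesis
      using \<U>(2) \<open>spec_le X x y\<close> by (simp add: spec_le_def)
  qed
  have "K \<noteq> {}" "K \<subseteq> topspace X"
    using K by (simp_all add: compact_saturated_sets_def compactin_subset_topspace)
  then show "K \<in> up_sets X"
    unfolding up_sets_def mem_Collect_eq by (intro conjI ballI allI impI) (assumption+, rule upper)
qed

section \<open>Filtered families and saturations\<close>

text \<open>The definition of well-filteredness, read for the complement of an open set.\<close>

lemma well_filtered_closed_meets_Inter:
  assumes X: "well_filtered_space X"
    and \<K>: "\<K> \<subseteq> compact_saturated_sets X" "filtered_family \<K>"
    and C: "closedin X C" "\<And>K. K \<in> \<K> \<Longrightarrow> C \<inter> K \<noteq> {}"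
  obtains y where "y \<in> C" "\<And>K. K \<in> \<K> \<Longrightarrow> y \<in> K"
proof -
  obtain K0 where K0: "K0 \<in> \<K>"
    using \<K>(2) by (auto simp: filtered_family_def)
  have "\<not> \<Inter>\<K> \<subseteq> topspace X - C"
  proof
    assume "\<Inter>\<K> \<subseteq> topspace X - C"
    moreover have "openin X (topspace X - C)"
      using C(1) by blast
    ultimately obtain K where "K \<in> \<K>" "K \<subseteq> topspace X - C"
      using X \<K> unfolding well_filtered_space_def by meson
    then show False
      using C(2) by blast
  qed
  moreover have "\<Inter>\<K> \<subseteq> topspace X"
  proof -
    have "K0 \<subseteq> topspace X"
      using subsetD[OF \<K>(1) K0]
      by (simp add: compact_saturated_sets_def compactin_subset_topspace)
    then show ?thesis
      using K0 by blast
  qed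
  ultimately obtain y where "y \<in> C" "y \<in> \<Inter>\<K>"
    by blast
  then show thesis
    by (intro that) auto
qed

definition saturation :: "'a topology \<Rightarrow> 'a set \<Rightarrow> 'a set" where
  "saturation X S = topspace X \<inter> \<Inter>{U. openin X U \<and> S \<subseteq> U}"

lemma subset_saturation: "S \<subseteq> topspace X \<Longrightarrow> S \<subseteq> saturation X S"
  by (auto simp: saturation_def)

lemma saturation_subset_open: "\<lbrakk>openin X U; S \<subseteq> U\<rbrakk> \<Longrightarrow> saturation X S \<subseteq> U"
  by (auto simp: saturation_def)

lemma saturation_mono: "S \<subseteq> T \<Longrightarrow> saturation X S \<subseteq> saturation X T"
  by (force simp: saturation_def)

text \<open>Otherwise the complement of the closure of \<open>y\<close> would be an open set that contains \<open>S\<close>,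
  hence its saturation, but not \<open>y\<close>.\<close>

lemma closure_of_saturation_point_meets:
  assumes "y \<in> saturation X S" "S \<subseteq> topspace X"
  shows "X closure_of {y} \<inter> S \<noteq> {}"
proof
  assume disj: "X closure_of {y} \<inter> S = {}"
  have "saturation X S \<subseteq> topspace X - X closure_of {y}"
    using disj assms(2) by (intro saturation_subset_open) auto
  moreover have "y \<in> X closure_of {y}"
    using assms(1) by (simp add: saturation_def in_closure_of)
  ultimately show False
    using assms(1) by blast
qed

text \<open>Compactness passes to the saturation because the two sets have the same open
  neighbourhoods.\<close>

lemma saturation_compact_saturated:
  assumes S: "compactin X S" "S \<noteq> {}"
  shows "saturation X S \<in> compact_saturated_sets X"
proof -
  have up: "S \<subseteq> saturation X S"
    using S(1) by (intro subset_saturation compactin_subset_topspace)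
  have "compactin X (saturation X S)"
    unfolding compactin_def
  proof (intro conjI allI impI)
    show "saturation X S \<subseteq> topspace X"
      by (auto simp: saturation_def)
    fix \<U> assume \<U>: "(\<forall>U\<in>\<U>. openin X U) \<and> saturation X S \<subseteq> \<Union>\<U>"
    have cover: "S \<subseteq> \<Union>\<U>"
      using up conjunct2[OF \<U>] by (rule subset_trans)
    obtain \<F> where \<F>: "finite \<F>" "\<F> \<subseteq> \<U>" "S \<subseteq> \<Union>\<F>"
      using S(1) \<U> cover unfolding compactin_def by meson
    have "openin X (\<Union>\<F>)"
      using \<U> \<F>(2) by (intro openin_Union) auto
    then have "saturation X S \<subseteq> \<Union>\<F>"
      using \<F>(3) by (rule saturation_subset_open)
    then show "\<exists>\<F>. finite \<F> \<and> \<F> \<subseteq> \<U> \<and> saturation X S \<subseteq> \<Union>\<F>"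
      using \<F> by blast
  qed
  moreover have "saturatedin X (saturation X S)"
    unfolding saturatedin_def saturation_def
    by (intro exI[of _ "{U. openin X U \<and> S \<subseteq> U}"]) simp
  ultimately show ?thesis
    using up S(2) by (auto simp: compact_saturated_sets_def)
qed

section \<open>Minimal closed sets under continuous maps\<close>

text \<open>Let \<open>A\<close> be minimal for the family \<open>\<K>\<close>, and let \<open>f\<close> map \<open>X\<close> to a well-filtered space \<open>Y\<close>.
  The saturations of the images of \<open>A \<inter> K\<close>, for \<open>K\<close> in \<open>\<K>\<close>, form a filtered family that the
  closure of \<open>f ` A\<close> meets, so some \<open>y\<close> in that closure lies in all of them. The preimage of the
  closure of \<open>y\<close> then meets every \<open>A \<inter> K\<close>, and minimality puts all of \<open>A\<close> into it.\<close>

lemma RD_sets_closure_of_image: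
  assumes A: "A \<in> RD_sets X" and Y: "well_filtered_space Y" and f: "continuous_map X Y f"
  obtains y where "y \<in> topspace Y" "Y closure_of (f ` A) = Y closure_of {y}"
proof -
  obtain \<K> where cl: "closedin X A"
    and \<K>: "\<K> \<subseteq> compact_saturated_sets X" "filtered_family \<K>"
    and meets_all: "\<forall>K\<in>\<K>. A \<inter> K \<noteq> {}"
    and least: "\<forall>B. closedin X B \<and> (\<forall>K\<in>\<K>. B \<inter> K \<noteq> {}) \<and> B \<subseteq> A \<longrightarrow> B = A"
    using A unfolding RD_sets_def mem_Collect_eq by (elim conjE exE)
  have meets: "A \<inter> K \<noteq> {}" if "K \<in> \<K>" for K
    using meets_all that by (rule bspec)
  have minimal: "B = A" if "closedin X B" "\<And>K. K \<in> \<K> \<Longrightarrow> B \<inter> K \<noteq> {}" "B \<subseteq> A" for B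
    using least[rule_format, of B] that by simp
  have fX: "f ` topspace X \<subseteq> topspace Y"
    using f by (rule continuous_map_image_subset_topspace)
  have AX: "A \<subseteq> topspace X"
    using cl by (rule closedin_subset)
  have fAY: "f ` A \<subseteq> topspace Y"
    using AX fX by blast
  define L where "L K = saturation Y (f ` (A \<inter> K))" for K
  have L_up: "f ` (A \<inter> K) \<subseteq> L K" for K
    using fAY unfolding L_def by (intro subset_saturation) blast
  have L_sat: "L ` \<K> \<subseteq> compact_saturated_sets Y"
  proof
    fix Q assume "Q \<in> L ` \<K>"
    then obtain K where K: "K \<in> \<K>" "Q = L K"
      by blast
    have "compactin X K"
      using \<K>(1) K(1) by (auto simp: compact_saturated_sets_def)
    then have "compactin Y (f ` (A \<inter> K))"
      using image_compactin[OF closed_Int_compactin[OF cl] f] by blast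
    then show "Q \<in> compact_saturated_sets Y"
      using meets[OF K(1)] unfolding K(2) L_def by (intro saturation_compact_saturated) auto
  qed
  have L_filt: "filtered_family (L ` \<K>)"
    unfolding filtered_family_def
  proof (intro conjI ballI)
    show "L ` \<K> \<noteq> {}"
      using \<K>(2) by (auto simp: filtered_family_def)
    fix Q1 Q2 assume "Q1 \<in> L ` \<K>" "Q2 \<in> L ` \<K>"
    then obtain K1 K2 where K12: "K1 \<in> \<K>" "K2 \<in> \<K>" "Q1 = L K1" "Q2 = L K2"
      by blast
    then obtain K3 where K3: "K3 \<in> \<K>" "K3 \<subseteq> K1 \<inter> K2"
      using \<K>(2) unfolding filtered_family_def by meson
    have "L K3 \<subseteq> L K1" "L K3 \<subseteq> L K2"
      using K3(2) unfolding L_def by (auto intro!: saturation_mono)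
    then show "\<exists>Q3\<in>L ` \<K>. Q3 \<subseteq> Q1 \<inter> Q2"
      using K12 K3(1) by blast
  qed
  have "Y closure_of (f ` A) \<inter> Q \<noteq> {}" if Q: "Q \<in> L ` \<K>" for Q
  proof -
    obtain K where K: "K \<in> \<K>" "Q = L K"
      using Q by (rule imageE)
    obtain x where x: "x \<in> A" "x \<in> K"
      using meets[OF K(1)] by blast
    then have "f x \<in> Q"
      using L_up[of K] K(2) by auto
    moreover have "f x \<in> Y closure_of (f ` A)"
      using closure_of_subset[OF fAY] x(1) by auto
    ultimately show ?thesis
      by blast
  qed
  then obtain y where y: "y \<in> Y closure_of (f ` A)" "\<And>Q. Q \<in> L ` \<K> \<Longrightarrow> y \<in> Q"
    using well_filtered_closed_meets_Inter[OF Y L_sat L_filt closedin_closure_of] by metis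
  define B where "B = A \<inter> {x \<in> topspace X. f x \<in> Y closure_of {y}}"
  have "B = A"
  proof (rule minimal)
    show "closedin X B"
      unfolding B_def
      using cl closedin_continuous_map_preimage[OF f closedin_closure_of] by (rule closedin_Int)
    show "B \<subseteq> A"
      by (simp add: B_def)
    fix K assume K: "K \<in> \<K>"
    then have "y \<in> saturation Y (f ` (A \<inter> K))"
      using y(2) by (simp add: L_def)
    then have "Y closure_of {y} \<inter> f ` (A \<inter> K) \<noteq> {}"
      using fAY by (intro closure_of_saturation_point_meets) auto
    then show "B \<inter> K \<noteq> {}"
      using AX by (auto simp: B_def)
  qed
  then have "f ` A \<subseteq> Y closure_of {y}"
    by (auto simp: B_def)
  then have "Y closure_of (f ` A) = Y closure_of {y}"
    using y(1) by (intro equalityI closure_of_minimal) auto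
  moreover have "y \<in> topspace Y"
    using y(1) by (simp add: in_closure_of)
  ultimately show thesis
    by (rule that[rotated])
qed

lemma RD_sets_subset_WD_sets: "RD_sets X \<subseteq> WD_sets X"
proof
  fix A assume A: "A \<in> RD_sets X"
  have "\<exists>!y. y \<in> topspace Y \<and> Y closure_of (f ` A) = Y closure_of {y}"
    if Y: "well_filtered_space Y" and f: "continuous_map X Y f" for Y :: "'a set topology" and f
  proof -
    obtain y where "y \<in> topspace Y" "Y closure_of (f ` A) = Y closure_of {y}"
      using RD_sets_closure_of_image[OF A Y f] .
    moreover have "t0_space Y"
      using Y by (simp add: well_filtered_space_def)
    ultimately show ?thesis
      unfolding t0_space_closure_of_sing by metis
  qed
  then show "A \<in> WD_sets X"
    using A by (simp add: WD_sets_def RD_sets_def)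
qed

section \<open>Closures of points, and the strongest condition\<close>

lemma maximal_points_closure_of_sing:
  assumes "t0_space X" "y \<in> topspace X"
  shows "y \<in> maximal_points X (X closure_of {y})"
proof -
  have "b = y" if b: "b \<in> X closure_of {y}" and le: "spec_le X y b" for b
  proof -
    have "X closure_of {b} = X closure_of {y}"
      using b le by (intro equalityI closure_of_minimal) (auto simp: spec_le_def)
    then show ?thesis
      using assms le unfolding t0_space_closure_of_sing by (auto simp: spec_le_def)
  qed
  then show ?thesis
    using assms(2) by (auto simp: maximal_points_def in_closure_of)
qed

text \<open>The point \<open>y\<close> is the largest element of its closure, so an upper set that meets the closure
  contains \<open>y\<close>, and everything in the closure lies below it.\<close>

lemma closedin_down_closure_closure_of_sing:
  assumes K: "K \<in> up_sets X" and y: "y \<in> topspace X"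
  shows "closedin X (down_closure X (X closure_of {y} \<inter> K))"
proof (cases "X closure_of {y} \<inter> K = {}")
  case True
  then show ?thesis
    by (simp add: down_closure_def)
next
  case False
  then obtain x where x: "x \<in> X closure_of {y}" "x \<in> K"
    by blast
  have "spec_le X x y"
    using x(1) y in_closure_of[of x X "{y}"] by (simp add: spec_le_def)
  then have y_in: "y \<in> X closure_of {y} \<inter> K"
    using K x(2) y by (auto simp: up_sets_def in_closure_of)
  have "down_closure X (X closure_of {y} \<inter> K) = X closure_of {y}"
  proof
    show "down_closure X (X closure_of {y} \<inter> K) \<subseteq> X closure_of {y}"
      using spec_le_closedD[OF _ closedin_closure_of] by (auto simp: down_closure_def)
    show "X closure_of {y} \<subseteq> down_closure X (X closure_of {y} \<inter> K)"
    proof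
      fix z assume z: "z \<in> X closure_of {y}"
      then have "spec_le X z y"
        using y in_closure_of[of z X "{y}"] by (simp add: spec_le_def)
      then show "z \<in> down_closure X (X closure_of {y} \<inter> K)"
        using y_in unfolding down_closure_def by blast
    qed
  qed
  then show ?thesis
    by simp
qed

lemma well_filtered_space_WD_sets_up_sets:
  assumes X: "well_filtered_space X" and A: "A \<in> WD_sets X" and K: "K \<in> up_sets X"
  shows "maximal_points X A \<noteq> {} \<and> closedin X (down_closure X (A \<inter> K))"
proof -
  obtain y where y: "y \<in> topspace X" "X closure_of A = X closure_of {y}"
    using WD_sets_dest[OF A X continuous_map_id] by auto
  moreover have "closedin X A"
    using A by (simp add: WD_sets_def)
  ultimately have A_eq: "A = X closure_of {y}"
    by (simp add: closure_of_closedin)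
  have "t0_space X"
    using X by (simp add: well_filtered_space_def)
  then have "y \<in> maximal_points X A"
    using y(1) unfolding A_eq by (rule maximal_points_closure_of_sing)
  moreover have "closedin X (down_closure X (A \<inter> K))"
    using K y(1) unfolding A_eq by (rule closedin_down_closure_closure_of_sing)
  ultimately show ?thesis
    by blast
qed

section \<open>The weakest condition implies well-filteredness\<close>

text \<open>A minimal closed set \<open>D\<close> outside the open set equals each down-closure of \<open>D \<inter> K\<close>, so
  a maximal point of \<open>D\<close> cannot lie strictly below a point of \<open>D \<inter> K\<close> and belongs to \<open>K\<close>
  itself.\<close>

lemma well_filtered_space_if_RD_sets:
  assumes T0: "t0_space X"
    and RD: "\<And>A K. \<lbrakk>A \<in> RD_sets X; K \<in> compact_saturated_sets X\<rbrakk> \<Longrightarrow>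
      maximal_points X A \<noteq> {} \<and> closedin X (down_closure X (A \<inter> K))"
  shows "well_filtered_space X"
  unfolding well_filtered_space_def
proof (intro conjI allI impI T0)
  fix U \<K>
  assume "openin X U \<and> \<K> \<subseteq> compact_saturated_sets X \<and> filtered_family \<K> \<and> \<Inter>\<K> \<subseteq> U"
  then have U: "openin X U" "\<Inter>\<K> \<subseteq> U"
    and \<K>: "\<K> \<subseteq> compact_saturated_sets X" "filtered_family \<K>"
    by auto
  have comp: "compactin X K" if "K \<in> \<K>" for K
    using \<K>(1) that by (auto simp: compact_saturated_sets_def)
  show "\<exists>K\<in>\<K>. K \<subseteq> U"
  proof (rule ccontr)
    assume neg: "\<not> (\<exists>K\<in>\<K>. K \<subseteq> U)"
    have "(topspace X - U) \<inter> K \<noteq> {}" if "K \<in> \<K>" for K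
      using neg that compactin_subset_topspace[OF comp[OF that]] by blast
    moreover have "closedin X (topspace X - U)"
      using U(1) by blast
    ultimately obtain D where D: "closedin X D" "D \<subseteq> topspace X - U"
      and meets: "\<And>K. K \<in> \<K> \<Longrightarrow> D \<inter> K \<noteq> {}"
      and minimal: "\<And>B. \<lbrakk>closedin X B; B \<subseteq> D; \<And>K. K \<in> \<K> \<Longrightarrow> B \<inter> K \<noteq> {}\<rbrakk> \<Longrightarrow> B = D"
      using minimal_closed_meeting[of \<K> X "topspace X - U"] comp by blast
    obtain K0 where K0: "K0 \<in> \<K>"
      using \<K>(2) by (auto simp: filtered_family_def)
    have D_RD: "D \<in> RD_sets X"
      unfolding RD_sets_def mem_Collect_eq
    proof (intro conjI exI[of _ \<K>] allI impI ballI D(1) \<K>)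
      show "D \<noteq> {}"
        using meets[OF K0] by blast
      show "D \<inter> K \<noteq> {}" if "K \<in> \<K>" for K
        using that by (rule meets)
      show "B = D" if "closedin X B \<and> (\<forall>K\<in>\<K>. B \<inter> K \<noteq> {}) \<and> B \<subseteq> D" for B
        using that by (intro minimal) simp_all
    qed
    have down: "down_closure X (D \<inter> K) = D" if K: "K \<in> \<K>" for K
    proof (rule minimal)
      show "closedin X (down_closure X (D \<inter> K))"
        using RD[OF D_RD subsetD[OF \<K>(1) K]] by (rule conjunct2)
      show "down_closure X (D \<inter> K) \<subseteq> D"
        using spec_le_closedD[OF _ D(1)] by (auto simp: down_closure_def)
      fix K' assume "K' \<in> \<K>"
      \<comment> \<open>filteredness turns a point of \<open>D\<close> in a common member into one of \<open>D \<inter> K\<close> in \<open>K'\<close>\<close>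
      then obtain K'' where "K'' \<in> \<K>" "K'' \<subseteq> K \<inter> K'"
        using \<K>(2) K unfolding filtered_family_def by meson
      then obtain x where "x \<in> D" "x \<in> K" "x \<in> K'"
        using meets by blast
      moreover have "spec_le X x x"
        using \<open>x \<in> D\<close> D(2) by (intro spec_le_refl) auto
      ultimately show "down_closure X (D \<inter> K) \<inter> K' \<noteq> {}"
        by (auto simp: down_closure_def)
    qed
    have "maximal_points X D \<noteq> {}"
      using RD[OF D_RD subsetD[OF \<K>(1) K0]] by (rule conjunct1)
    then obtain m where m: "m \<in> D" "\<And>b. \<lbrakk>b \<in> D; spec_le X m b\<rbrakk> \<Longrightarrow> b = m"
      by (auto simp: maximal_points_def)
    have "m \<in> K" if K: "K \<in> \<K>" for K
    proof -
      have "m \<in> down_closure X (D \<inter> K)"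
        using down[OF K] m(1) by simp
      then obtain b where "b \<in> D" "b \<in> K" "spec_le X m b"
        by (auto simp: down_closure_def)
      then show ?thesis
        using m(2) by blast
    qed
    then have "m \<in> U"
      using U(2) by (simp add: subset_iff)
    then show False
      using m(1) D(2) by blast
  qed
qed

section \<open>The equivalences\<close>

theorem theorem3p9:
  fixes X :: "'a topology"
  assumes "t0_space X"
  shows "(well_filtered_space X \<longleftrightarrow>
            (\<forall>A\<in>WD_sets X. \<forall>K\<in>up_sets X.
               maximal_points X A \<noteq> {} \<and> closedin X (down_closure X (A \<inter> K)))) \<and>
         (well_filtered_space X \<longleftrightarrow>
            (\<forall>A\<in>RD_sets X. \<forall>K\<in>up_sets X.
               maximal_points X A \<noteq> {} \<and> closedin X (down_closure X (A \<inter> K)))) \<and>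
         (well_filtered_space X \<longleftrightarrow>
            (\<forall>A\<in>WD_sets X. \<forall>K\<in>compact_saturated_sets X.
               maximal_points X A \<noteq> {} \<and> closedin X (down_closure X (A \<inter> K)))) \<and>
         (well_filtered_space X \<longleftrightarrow>
            (\<forall>A\<in>RD_sets X. \<forall>K\<in>compact_saturated_sets X.
               maximal_points X A \<noteq> {} \<and> closedin X (down_closure X (A \<inter> K))))"
proof -
  define cond where "cond \<A> \<K> \<longleftrightarrow> (\<forall>A\<in>\<A>. \<forall>K\<in>\<K>.
    maximal_points X A \<noteq> {} \<and> closedin X (down_closure X (A \<inter> K)))" for \<A> \<K>
  have antimono: "cond \<A>' \<K>'" if "cond \<A> \<K>" "\<A>' \<subseteq> \<A>" "\<K>' \<subseteq> \<K>" for \<A> \<A>' \<K> \<K>'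
    using that unfolding cond_def by blast
  let ?C = "compact_saturated_sets X"
  have strongest: "cond (WD_sets X) (up_sets X)" if "well_filtered_space X"
    using well_filtered_space_WD_sets_up_sets[OF that] unfolding cond_def by blast
  have weakest: "well_filtered_space X" if "cond (RD_sets X) ?C"
    using well_filtered_space_if_RD_sets[OF assms] that unfolding cond_def by blast
  have sandwiched: "well_filtered_space X \<longleftrightarrow> cond \<A> \<K>"
    if "RD_sets X \<subseteq> \<A>" "\<A> \<subseteq> WD_sets X" "?C \<subseteq> \<K>" "\<K> \<subseteq> up_sets X" for \<A> \<K>
    using antimono[OF strongest that(2,4)] weakest[OF antimono[OF _ that(1,3)]] by (rule iffI)
  show ?thesis
    unfolding cond_def[symmetric]
    by (intro conjI sandwiched subset_refl RD_sets_subset_WD_sets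
        compact_saturated_sets_subset_up_sets)
qed

end
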